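(* Consider the problem $\min_{x\in\mathbb{R}^N} g(x)+F(x)$, $F=\frac1n\sum_{i=1}^n f_i$, under the Problem Properties assumption, with unique solution $x^\star$, and the SAGA algorithm (see context) with sampling distribution and step-size $$p_i\propto 4L_i+n\mu+\sqrt{(4L_i)^2+(n\mu)^2},\qquad \lambda=\frac2S,$$ where $S=\frac1n\sum_{i=1}^n\big(4L_i+n\mu+\sqrt{(4L_i)^2+(n\mu)^2}\big)$ and the $p_i$ are normalized so that $\sum_ip_i=1$. Then SAGA converges with rate $\mathbb{E}\|x^k-x^\star\|^2\in\mathcal{O}\big((1-\mu\lambda)^k\big)$, and it achieves an $\epsilon$-accurate solution in expectation, i.e. $\mathbb{E}\|x^k-x^\star\|^2\le\epsilon$, within $$\mathcal{O}\Big(\frac12\Big(\frac1n\sum_{i=1}^n\Big(\frac{4L_i}{\mu}+n+\sqrt{\big(\tfrac{4L_i}{\mu}\big)^2+n^2}\Big)\Big)\log\frac1\epsilon\Big)$$ iterations.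
   Context: Problem Properties: $g:\mathbb{R}^N\to\mathbb{R}\cup\{\infty\}$ is closed, convex and proper. For every $i\in\{1,\dots,n\}$, $f_i:\mathbb{R}^N\to\mathbb{R}$ is convex, differentiable and $L_i$-smooth. $F=\frac1n\sum_{i=1}^n f_i$ is $\mu$-strongly convex, differentiable and $L$-smooth with $L\le\frac1n\sum_{i=1}^nL_i$. Here a convex $f$ is $L$-smooth ($L>0$) if it is differentiable and $\langle\nabla f(x)-\nabla f(y),x-y\rangle\ge\frac1L\|\nabla f(x)-\nabla f(y)\|^2$ for all $x,y$ (equivalently, $\nabla f$ is $L$-Lipschitz), and $f$ is $\mu$-strongly convex ($\mu>0$) if $f-\frac\mu2\|\cdot\|^2$ is convex. The norm is Euclidean, and $\operatorname{prox}_{\lambda g}(z)=\arg\min_x \lambda g(x)+\frac12\|x-z\|^2$. SAGA algorithm: given initial points $x^0,y_1^0,\dots,y_n^0\in\mathbb{R}^N$ and step-size $\lambda>0$, for $k=0,1,\dots$ sample $I^k\in\{1,\dots,n\}$, independently and identically distributed over $k$ with $P(I^k=i)=p_i>0$, and set $$z^{k+1}=x^k-\tfrac{\lambda}{n}\Big(\tfrac1{p_{I^k}}(\nabla f_{I^k}(x^k)-y_{I^k}^k)+\sum_{i=1}^ny_i^k\Big),\quad x^{k+1}=\operatorname{prox}_{\lambda g}(z^{k+1}),$$ $y_{I^k}^{k+1}=\nabla f_{I^k}(x^k)$ and $y_i^{k+1}=y_i^k$ for $i\ne I^k$. The iteration-complexity $\mathcal{O}(\cdot)$ is asymptotic as $\epsilon\to0$: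 the implied constant is absolute, and the bound holds for all $\epsilon$ below a threshold that may depend on the problem and the initial points. *)

theory Defs
  imports "HOL-Probability.Probability" "HOL-Library.Landau_Symbols"
begin

definition grad :: "('a::real_inner \<Rightarrow> real) \<Rightarrow> 'a \<Rightarrow> 'a" where
  "grad f x = (THE D. GDERIV f x :> D)"

definition smooth :: "real \<Rightarrow> ('a::real_inner \<Rightarrow> real) \<Rightarrow> bool" where
  "smooth L f \<longleftrightarrow> L > 0 \<and> (\<forall>x. f differentiable (at x)) \<and>
     (\<forall>x y. (grad f x - grad f y) \<bullet> (x - y) \<ge> 1 / L * (norm (grad f x - grad f y))\<^sup>2)"

definition strongly_convex :: "real \<Rightarrow> ('a::real_inner \<Rightarrow> real) \<Rightarrow> bool" where
  "strongly_convex \<mu> f \<longleftrightarrow> \<mu> > 0 \<and> convex_on UNIV (\<lambda>x. f x - \<mu> / 2 * (norm x)\<^sup>2)"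

text \<open>Only the finite levels enter the epigraph: it is a subset of \<open>'a \<times> real\<close>.\<close>

definition ereal_epigraph :: "('a \<Rightarrow> ereal) \<Rightarrow> ('a \<times> real) set" where
  "ereal_epigraph g = {(x, t). g x \<le> ereal t}"

definition closed_convex_proper :: "('a::real_normed_vector \<Rightarrow> ereal) \<Rightarrow> bool" where
  "closed_convex_proper g \<longleftrightarrow>
     closed (ereal_epigraph g) \<and> convex (ereal_epigraph g) \<and>
     (\<forall>x. g x \<noteq> - \<infinity>) \<and> (\<exists>x. g x \<noteq> \<infinity>)"

definition prox :: "real \<Rightarrow> ('a::real_normed_vector \<Rightarrow> ereal) \<Rightarrow> 'a \<Rightarrow> 'a" where
  "prox lam g z = arg_min (\<lambda>x. ereal lam * g x + ereal (1 / 2 * (norm (x - z))\<^sup>2)) (\<lambda>_. True)"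

definition avg :: "nat \<Rightarrow> (nat \<Rightarrow> 'a \<Rightarrow> real) \<Rightarrow> 'a \<Rightarrow> real" where
  "avg n f x = 1 / real n * (\<Sum>i = 1..n. f i x)"

definition problem_properties ::
    "nat \<Rightarrow> ('a::real_inner \<Rightarrow> ereal) \<Rightarrow> (nat \<Rightarrow> 'a \<Rightarrow> real) \<Rightarrow> (nat \<Rightarrow> real) \<Rightarrow> real \<Rightarrow> real \<Rightarrow> bool" where
  "problem_properties n g f Ls L \<mu> \<longleftrightarrow>
     n \<ge> 1 \<and> closed_convex_proper g \<and>
     (\<forall>i\<in>{1..n}. convex_on UNIV (f i) \<and> smooth (Ls i) (f i)) \<and>
     strongly_convex \<mu> (avg n f) \<and> smooth L (avg n f) \<and>
     L \<le> 1 / real n * (\<Sum>i = 1..n. Ls i)"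

definition solutions :: "nat \<Rightarrow> ('a \<Rightarrow> ereal) \<Rightarrow> (nat \<Rightarrow> 'a \<Rightarrow> real) \<Rightarrow> 'a set" where
  "solutions n g f = {x. is_arg_min (\<lambda>x. g x + ereal (avg n f x)) (\<lambda>_. True) x}"

text \<open>The state is the pair of \<open>x\<^sup>k\<close> and the table \<open>y\<^sup>k\<close>, of which only the entries
  \<open>1, \<dots>, n\<close> matter; \<open>i\<close> is the sampled index.\<close>

definition saga_step ::
    "nat \<Rightarrow> ('a::real_inner \<Rightarrow> ereal) \<Rightarrow> (nat \<Rightarrow> 'a \<Rightarrow> real) \<Rightarrow> (nat \<Rightarrow> real) \<Rightarrow> real \<Rightarrow> nat
      \<Rightarrow> 'a \<times> (nat \<Rightarrow> 'a) \<Rightarrow> 'a \<times> (nat \<Rightarrow> 'a)" where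
  "saga_step n g f p lam i s =
     (let x = fst s; y = snd s;
          z = x - (lam / real n) *\<^sub>R ((1 / p i) *\<^sub>R (grad (f i) x - y i) + (\<Sum>j = 1..n. y j))
      in (prox lam g z, y(i := grad (f i) x)))"

primrec saga ::
    "nat \<Rightarrow> ('a::real_inner \<Rightarrow> ereal) \<Rightarrow> (nat \<Rightarrow> 'a \<Rightarrow> real) \<Rightarrow> (nat \<Rightarrow> real) \<Rightarrow> real
      \<Rightarrow> 'a \<Rightarrow> (nat \<Rightarrow> 'a) \<Rightarrow> (nat \<Rightarrow> nat) \<Rightarrow> nat \<Rightarrow> 'a \<times> (nat \<Rightarrow> 'a)" where
  "saga n g f p lam x0 y0 i 0 = (x0, y0)"
| "saga n g f p lam x0 y0 i (Suc k) = saga_step n g f p lam (i k) (saga n g f p lam x0 y0 i k)"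

definition iid_sampling :: "nat \<Rightarrow> (nat \<Rightarrow> real) \<Rightarrow> 'w measure \<Rightarrow> (nat \<Rightarrow> 'w \<Rightarrow> nat) \<Rightarrow> bool" where
  "iid_sampling n p M I \<longleftrightarrow>
     prob_space M \<and>
     prob_space.indep_vars M (\<lambda>_. count_space {1..n}) I UNIV \<and>
     (\<forall>k. \<forall>i\<in>{1..n}. measure M {\<omega> \<in> space M. I k \<omega> = i} = p i)"

text \<open>\<open>E \<parallel>x\<^sup>k - x\<^sup>\<star>\<parallel>\<^sup>2\<close>. Under \<open>iid_sampling\<close> the integrand takes finitely many values and is
  measurable, so the Bochner integral is a genuine expectation.\<close>

definition saga_mse ::
    "'w measure \<Rightarrow> (nat \<Rightarrow> 'w \<Rightarrow> nat) \<Rightarrow> nat \<Rightarrow> ('a::real_inner \<Rightarrow> ereal) \<Rightarrow> (nat \<Rightarrow> 'a \<Rightarrow> real)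
      \<Rightarrow> (nat \<Rightarrow> real) \<Rightarrow> real \<Rightarrow> 'a \<Rightarrow> (nat \<Rightarrow> 'a) \<Rightarrow> 'a \<Rightarrow> nat \<Rightarrow> real" where
  "saga_mse M I n g f p lam x0 y0 xs k =
     (LINT \<omega>|M. (norm (fst (saga n g f p lam x0 y0 (\<lambda>j. I j \<omega>) k) - xs))\<^sup>2)"

definition saga_weight :: "nat \<Rightarrow> (nat \<Rightarrow> real) \<Rightarrow> real \<Rightarrow> nat \<Rightarrow> real" where
  "saga_weight n Ls \<mu> i =
     4 * Ls i + real n * \<mu> + sqrt ((4 * Ls i)\<^sup>2 + (real n * \<mu>)\<^sup>2)"

definition saga_prob :: "nat \<Rightarrow> (nat \<Rightarrow> real) \<Rightarrow> real \<Rightarrow> nat \<Rightarrow> real" where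
  "saga_prob n Ls \<mu> i = saga_weight n Ls \<mu> i / (\<Sum>j = 1..n. saga_weight n Ls \<mu> j)"

definition saga_S :: "nat \<Rightarrow> (nat \<Rightarrow> real) \<Rightarrow> real \<Rightarrow> real" where
  "saga_S n Ls \<mu> = 1 / real n * (\<Sum>i = 1..n. saga_weight n Ls \<mu> i)"

definition saga_stepsize :: "nat \<Rightarrow> (nat \<Rightarrow> real) \<Rightarrow> real \<Rightarrow> real" where
  "saga_stepsize n Ls \<mu> = 2 / saga_S n Ls \<mu>"

text \<open>The absolute constant implied by the \<open>\<O>\<close> of the iteration complexity. An existentially
  quantified constant could depend on the type variables of the theorem, in particular on the
  dimension \<open>N\<close>; HOL can express independence of these only by a closed term, so a witness is
  fixed. Any value greater than 1 would do.\<close>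

definition complexity_const :: real where
  "complexity_const = 2"

text \<open>An error sequence \<open>e\<close> is \<open>\<epsilon>\<close>-accurate within \<open>B\<close> iterations: it drops to \<open>\<epsilon>\<close> after at most
  \<open>B\<close> steps and stays there.\<close>

definition accurate_within :: "(nat \<Rightarrow> real) \<Rightarrow> real \<Rightarrow> real \<Rightarrow> bool" where
  "accurate_within e \<epsilon> B \<longleftrightarrow> (\<exists>K. real K \<le> B \<and> (\<forall>k\<ge>K. e k \<le> \<epsilon>))"

end

theory Submission
  imports Defs
begin

text \<open>The proof is a Lyapunov argument for
  \<open>V(x, y) = \<parallel>x - xs\<parallel>\<^sup>2 + \<Sum>\<^sub>i c\<^sub>i \<parallel>y\<^sub>i - \<nabla>f\<^sub>i(xs)\<parallel>\<^sup>2\<close>, with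
  \<open>c\<^sub>i = 2\<lambda>\<^sup>2 / (n\<^sup>2 p\<^sub>i (p\<^sub>i - \<mu>\<lambda>))\<close>: averaged over the next index, \<open>V\<close> shrinks by the factor
  \<open>1 - \<mu>\<lambda>\<close>.

  Since \<open>xs\<close> is the proximal point of \<open>xs - \<lambda>\<nabla>F(xs)\<close>, the proximal step can only decrease the
  distance (\<open>prox_nonexpansive_at_solution\<close>), and \<open>\<parallel>x - xs\<parallel>\<^sup>2\<close> is estimated for the gradient step
  alone. The stochastic gradient is unbiased, and the second moment of its deviation from
  \<open>\<nabla>F(xs)\<close> is at most twice that of the scaled gradient differences
  \<open>(\<nabla>f\<^sub>i(x) - \<nabla>f\<^sub>i(xs)) / (n p\<^sub>i)\<close> plus twice that of the scaled table errors
  \<open>(y\<^sub>i - \<nabla>f\<^sub>i(xs)) / (n p\<^sub>i)\<close> (\<open>control_variate_second_moment\<close>).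
  The table errors are paid for by the refresh of a table entry with probability \<open>p\<^sub>i\<close>, which reduces the second part of \<open>V\<close>; this fixes \<open>c\<^sub>i\<close> and needs
  \<open>p\<^sub>i > \<mu>\<lambda>\<close>. The gradient differences are paid for by cocoercivity of the individual gradients,
  which leaves the condition \<open>(2\<lambda>/n) (1/p\<^sub>i + 1/(p\<^sub>i - \<mu>\<lambda>)) \<le> 1/L\<^sub>i\<close>. The sampling distribution and
  step-size are those for which it holds with equality for every \<open>i\<close> (\<open>saga_weight_balance\<close>).

  Two points are not part of this computation. The proximal map is a choice of minimizer, so a
  minimizer has to exist: optimality of \<open>xs\<close> gives an affine minorant of \<open>g\<close>, which makes the
  proximal objective coercive (\<open>prox_is_arg_min\<close>). And the one-step estimate passes to expectations
  because the state after \<open>k\<close> steps is a function of the first \<open>k\<close> indices, of which the next one is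
  independent (\<open>expectation_condition_on_history\<close>).\<close>

section \<open>Gradients and first-order optimality\<close>

lemma GDERIV_grad:
  fixes f :: "'a::euclidean_space \<Rightarrow> real"
  assumes "f differentiable (at x)"
  shows "GDERIV f x :> grad f x"
proof -
  obtain f' where f': "(f has_derivative f') (at x)"
    using assms by (auto simp: differentiable_def)
  \<comment> \<open>the Riesz representative of the linear form \<open>f'\<close> is \<open>adjoint f' 1\<close>\<close>
  have lin: "linear f'" using f' has_derivative_linear by blast
  have "f' h = h \<bullet> adjoint f' 1" for h
    using adjoint_works[OF lin, of h 1] by simp
  then have "f' = (\<lambda>h. h \<bullet> adjoint f' 1)" by blast
  then have D: "GDERIV f x :> adjoint f' 1"
    using f' by (simp add: gderiv_def)
  have "D' = adjoint f' 1" if "GDERIV f x :> D'" for D'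
  proof -
    have "(\<lambda>h. h \<bullet> D') = (\<lambda>h. h \<bullet> adjoint f' 1)"
      using has_derivative_unique that D unfolding gderiv_def by blast
    then have "h \<bullet> D' = h \<bullet> adjoint f' 1" for h by meson
    then show ?thesis by (metis vector_eq_ldot)
  qed
  then show ?thesis unfolding grad_def using D by (metis theI)
qed

lemma GDERIV_avg:
  fixes f :: "nat \<Rightarrow> 'a::euclidean_space \<Rightarrow> real"
  assumes "\<And>i. i \<in> {1..n} \<Longrightarrow> f i differentiable (at x)"
  shows "GDERIV (avg n f) x :> (1 / real n) *\<^sub>R (\<Sum>i = 1..n. grad (f i) x)"
proof -
  have "((\<lambda>x. \<Sum>i = 1..n. f i x) has_derivative (\<lambda>h. \<Sum>i = 1..n. h \<bullet> grad (f i) x)) (at x)"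
    using GDERIV_grad[OF assms] by (intro has_derivative_sum) (auto simp: gderiv_def)
  from has_derivative_mult_right[OF this, of "1 / real n"]
  show ?thesis
    unfolding gderiv_def avg_def by (simp add: inner_sum_right)
qed

text \<open>Convexity is imposed on a set of pairs (point, level), not on a function, so that
  extended-valued functions and the tangent inequality below are both instances. The slope at
  \<open>0\<close> of the objective along the segment from \<open>(q, s)\<close> to \<open>(x, t)\<close> cannot be negative.\<close>

lemma first_order_optimality:
  fixes \<phi> :: "'a::real_inner \<Rightarrow> real"
  assumes E: "convex E" and qs: "(q, s) \<in> E" and xt: "(x, t) \<in> E"
    and grad: "GDERIV \<phi> q :> D"
    and min: "\<And>y r. (y, r) \<in> E \<Longrightarrow> c * s + \<phi> q \<le> c * r + \<phi> y"
  shows "c * s \<le> c * t + D \<bullet> (x - q)"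
proof (rule ccontr)
  define \<psi> where "\<psi> u = u * (c * (t - s)) + \<phi> (q + u *\<^sub>R (x - q))" for u :: real
  assume "\<not> ?thesis"
  then have neg: "c * (t - s) + (x - q) \<bullet> D < 0" by (simp add: algebra_simps inner_commute)
  have "((\<lambda>u. q + u *\<^sub>R (x - q)) has_derivative (\<lambda>u. u *\<^sub>R (x - q))) (at 0)"
    by (auto intro!: derivative_eq_intros)
  moreover have "(\<phi> has_derivative (\<lambda>h. h \<bullet> D)) (at (q + 0 *\<^sub>R (x - q)))"
    using grad by (simp add: gderiv_def)
  ultimately have "((\<lambda>u. \<phi> (q + u *\<^sub>R (x - q))) has_derivative (\<lambda>u. (u *\<^sub>R (x - q)) \<bullet> D)) (at 0)"
    by (rule has_derivative_compose)
  then have "(\<psi> has_derivative (\<lambda>u. u * (c * (t - s)) + (u *\<^sub>R (x - q)) \<bullet> D)) (at 0)"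
    unfolding \<psi>_def by (intro has_derivative_add) (auto intro!: derivative_eq_intros)
  then have "(\<psi> has_field_derivative (c * (t - s) + (x - q) \<bullet> D)) (at 0)"
    unfolding has_field_derivative_def
    by (rule has_derivative_eq_rhs) (auto simp: algebra_simps)
  from DERIV_neg_dec_right[OF this neg] obtain d where
    d: "d > 0" "\<And>h. h > 0 \<Longrightarrow> h < d \<Longrightarrow> \<psi> h < \<psi> 0" by auto
  define u where "u = min (d / 2) 1"
  have u: "0 < u" "u < d" "u \<le> 1" using d by (auto simp: u_def)
  have "(1 - u) *\<^sub>R (q, s) + u *\<^sub>R (x, t) \<in> E"
    using E qs xt u by (intro convexD) auto
  also have "(1 - u) *\<^sub>R (q, s) + u *\<^sub>R (x, t) = (q + u *\<^sub>R (x - q), s + u * (t - s))"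
    by (simp add: algebra_simps)
  finally have "c * s + \<phi> q \<le> c * (s + u * (t - s)) + \<phi> (q + u *\<^sub>R (x - q))" by (rule min)
  then have "\<psi> 0 \<le> \<psi> u" by (simp add: \<psi>_def algebra_simps)
  with d(2)[OF u(1,2)] show False by simp
qed

text \<open>On the epigraph of \<open>h\<close>, the level minus \<open>h\<close> is minimal on the graph, so this is the
  optimality condition with the smooth part \<open>-h\<close>.\<close>

lemma convex_tangent_below:
  fixes h :: "'a::real_inner \<Rightarrow> real"
  assumes "convex_on UNIV h" and "GDERIV h x :> D"
  shows "h x + D \<bullet> (y - x) \<le> h y"
proof -
  have "GDERIV (\<lambda>x. - h x) x :> - D" using assms(2) by (rule GDERIV_minus)
  moreover have "convex (epigraph UNIV h)" using assms(1) by (simp only: convex_epigraph convex_UNIV)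
  ultimately have "1 * h x \<le> 1 * h y + (- D) \<bullet> (y - x)"
    by (intro first_order_optimality[where E = "epigraph UNIV h" and \<phi> = "\<lambda>x. - h x"])
      (auto simp: mem_epigraph)
  then show ?thesis by simp
qed

text \<open>Adding the two tangent inequalities of the convex function \<open>F - \<mu>/2 \<parallel>\<cdot>\<parallel>\<^sup>2\<close> at \<open>x\<close> and \<open>y\<close>.\<close>

lemma strongly_convex_gradient_monotone:
  fixes F :: "'a::real_inner \<Rightarrow> real"
  assumes "strongly_convex \<mu> F" and x: "GDERIV F x :> D" and y: "GDERIV F y :> D'"
  shows "\<mu> * (norm (x - y))\<^sup>2 \<le> (x - y) \<bullet> (D - D')"
proof -
  define h where "h z = F z - \<mu> / 2 * (norm z)\<^sup>2" for z
  have conv: "convex_on UNIV h" using assms(1) unfolding strongly_convex_def h_def by blast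
  have der: "GDERIV h z :> C - \<mu> *\<^sub>R z" if "GDERIV F z :> C" for z C
    using that unfolding gderiv_def h_def power2_norm_eq_inner
    by (auto intro!: derivative_eq_intros simp: algebra_simps inner_commute)
  have "h x + (D - \<mu> *\<^sub>R x) \<bullet> (y - x) \<le> h y" "h y + (D' - \<mu> *\<^sub>R y) \<bullet> (x - y) \<le> h x"
    using convex_tangent_below[OF conv der] x y by blast+
  then show ?thesis
    by (simp add: power2_norm_eq_inner algebra_simps inner_commute)
qed

section \<open>The proximal step\<close>

text \<open>The affine minorant of \<open>g\<close> makes the proximal objective coercive: the part of the epigraph
  on which the objective does not exceed its value at \<open>(xs, s)\<close> lies in a ball times an interval,
  hence is compact.\<close>

lemma prox_is_arg_min:
  fixes g :: "'a::euclidean_space \<Rightarrow> ereal"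
  assumes g: "closed_convex_proper g" and lam: "lam > 0" and gxs: "g xs = ereal s"
    and minorant: "\<And>x t. (x, t) \<in> ereal_epigraph g \<Longrightarrow> s \<le> t + D \<bullet> (x - xs)"
  shows "is_arg_min (\<lambda>x. ereal lam * g x + ereal (1 / 2 * (norm (x - z))\<^sup>2)) (\<lambda>_. True)
    (prox lam g z)"
proof -
  define J where "J w = lam * snd w + 1 / 2 * (norm (fst w - z))\<^sup>2" for w :: "'a \<times> real"
  define Q where "Q = {w \<in> ereal_epigraph g. J w \<le> J (xs, s)}"
  have contJ: "continuous_on A J" for A unfolding J_def by (intro continuous_intros)
  have xsQ: "(xs, s) \<in> Q" by (simp add: Q_def ereal_epigraph_def gxs)
  have "closed {w. J w \<le> J (xs, s)}" using contJ by (intro closed_Collect_le) auto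
  then have closedQ: "closed Q"
    using g unfolding Q_def closed_convex_proper_def by (simp add: Collect_conj_eq closed_Int)
  define K where "K = J (xs, s) - lam * s + lam * (D \<bullet> (z - xs))"
  define \<rho> where "\<rho> = sqrt (2 * K + lam\<^sup>2 * (norm D)\<^sup>2)"
  define R where "R = \<rho> + norm (z + lam *\<^sub>R D - xs)"
  have "w \<in> cball (z + lam *\<^sub>R D) \<rho> \<times> {s - norm D * R .. J (xs, s) / lam}" if w: "w \<in> Q" for w
  proof -
    obtain x t where wxt: "w = (x, t)" by force
    have t: "s \<le> t + D \<bullet> (x - xs)" using w minorant by (simp add: Q_def wxt)
    have J: "lam * t + 1 / 2 * (norm (x - z))\<^sup>2 \<le> J (xs, s)" using w by (simp add: Q_def J_def wxt)
    have "lam * s \<le> lam * (t + D \<bullet> (x - xs))" using t lam by simp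
    then have "lam * s - lam * (D \<bullet> (x - xs)) + 1 / 2 * (norm (x - z))\<^sup>2 \<le> J (xs, s)"
      using J by (simp add: algebra_simps)
    \<comment> \<open>completing the square in \<open>x\<close>\<close>
    then have "(norm (x - (z + lam *\<^sub>R D)))\<^sup>2 \<le> 2 * K + lam\<^sup>2 * (norm D)\<^sup>2"
      unfolding K_def power2_norm_eq_inner
      by (simp add: algebra_simps inner_commute power2_eq_square)
    then have x: "norm (x - (z + lam *\<^sub>R D)) \<le> \<rho>"
      unfolding \<rho>_def by (rule real_le_rsqrt)
    have "norm (x - xs) \<le> R"
      using norm_triangle_ineq[of "x - (z + lam *\<^sub>R D)" "z + lam *\<^sub>R D - xs"] x
      by (simp add: R_def)
    then have "D \<bullet> (x - xs) \<le> norm D * R"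
      using norm_cauchy_schwarz[of D "x - xs"] mult_left_mono[of "norm (x - xs)" R "norm D"]
      by simp
    moreover have "t * lam \<le> J (xs, s)" using J zero_le_power2[of "norm (x - z)"] by argo
    then have "t \<le> J (xs, s) / lam" using lam by (simp add: pos_le_divide_eq)
    ultimately show ?thesis using t x by (simp add: wxt dist_norm norm_minus_commute)
  qed
  then have "Q \<subseteq> cball (z + lam *\<^sub>R D) \<rho> \<times> {s - norm D * R .. J (xs, s) / lam}" by blast
  then have "bounded Q"
    by (rule bounded_subset[OF bounded_Times[OF bounded_cball bounded_closed_interval]])
  then have "compact Q" using closedQ by (simp add: compact_eq_bounded_closed)
  then obtain w where w: "w \<in> Q" "\<And>v. v \<in> Q \<Longrightarrow> J w \<le> J v"
    using continuous_attains_inf[of Q J] contJ xsQ by blast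
  have le: "ereal lam * g (fst w) + ereal (1 / 2 * (norm (fst w - z))\<^sup>2)
      \<le> ereal lam * g x + ereal (1 / 2 * (norm (x - z))\<^sup>2)" for x
  proof (cases "g x")
    case (real r)
    have "J w \<le> J (x, r)"
    proof (cases "J (x, r) \<le> J (xs, s)")
      case True
      then show ?thesis using real by (intro w(2)) (simp add: Q_def ereal_epigraph_def)
    next
      case False
      then show ?thesis using w(2)[OF xsQ] by linarith
    qed
    then have "ereal (J w) \<le> ereal lam * g x + ereal (1 / 2 * (norm (x - z))\<^sup>2)"
      by (simp add: real J_def)
    moreover have "g (fst w) \<le> ereal (snd w)" using w(1) by (auto simp: Q_def ereal_epigraph_def)
    then have "ereal lam * g (fst w) \<le> ereal lam * ereal (snd w)"
      using lam by (intro ereal_mult_left_mono) auto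
    then have "ereal lam * g (fst w) + ereal (1 / 2 * (norm (fst w - z))\<^sup>2) \<le> ereal (J w)"
      using add_right_mono[of "ereal lam * g (fst w)" "ereal lam * ereal (snd w)"
          "ereal (1 / 2 * (norm (fst w - z))\<^sup>2)"] by (simp add: J_def)
    ultimately show ?thesis by (rule order_trans[rotated])
  qed (use g lam in \<open>auto simp: closed_convex_proper_def\<close>)
  then have "is_arg_min (\<lambda>x. ereal lam * g x + ereal (1 / 2 * (norm (x - z))\<^sup>2)) (\<lambda>_. True) (fst w)"
    by (auto simp: is_arg_min_def not_less)
  then show ?thesis unfolding prox_def arg_min_def by (rule someI)
qed

text \<open>The minorant says that \<open>xs\<close> is the proximal point of \<open>xs - lam D\<close>. Adding it to the
  optimality condition of the proximal point of \<open>z\<close> gives firm nonexpansiveness for this pair.\<close>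

lemma prox_nonexpansive_at_solution:
  fixes g :: "'a::euclidean_space \<Rightarrow> ereal"
  assumes g: "closed_convex_proper g" and lam: "lam > 0" and gxs: "g xs = ereal s"
    and minorant: "\<And>x t. (x, t) \<in> ereal_epigraph g \<Longrightarrow> s \<le> t + D \<bullet> (x - xs)"
  shows "norm (prox lam g z - xs) \<le> norm (z - (xs - lam *\<^sub>R D))"
proof -
  define q where "q = prox lam g z"
  define \<phi> where "\<phi> x = 1 / 2 * (norm (x - z))\<^sup>2" for x
  have min: "ereal lam * g q + ereal (\<phi> q) \<le> ereal lam * g x + ereal (\<phi> x)" for x
    using prox_is_arg_min[OF assms, of z] by (auto simp: is_arg_min_def q_def \<phi>_def not_less)
  have "g q \<noteq> \<infinity>" using min[of xs] lam by (auto simp: gxs)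
  moreover have "g q \<noteq> -\<infinity>" using g by (simp add: closed_convex_proper_def)
  ultimately obtain r where r: "g q = ereal r" by (cases "g q") auto
  have "GDERIV \<phi> q :> q - z"
    unfolding gderiv_def \<phi>_def power2_norm_eq_inner
    by (auto intro!: derivative_eq_intros simp: algebra_simps inner_commute)
  moreover have "lam * r + \<phi> q \<le> lam * t + \<phi> x" if "(x, t) \<in> ereal_epigraph g" for x t
  proof -
    have "ereal lam * g x \<le> ereal lam * ereal t"
      using that lam by (intro ereal_mult_left_mono) (auto simp: ereal_epigraph_def)
    then have "ereal lam * g q + ereal (\<phi> q) \<le> ereal lam * ereal t + ereal (\<phi> x)"
      using min[of x] add_right_mono order_trans by blast
    then show ?thesis by (simp add: r)
  qed
  ultimately have 1: "lam * r \<le> lam * s + (q - z) \<bullet> (xs - q)"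
    using g gxs r by (intro first_order_optimality[where E = "ereal_epigraph g" and \<phi> = \<phi>])
      (auto simp: closed_convex_proper_def ereal_epigraph_def)
  have "s \<le> r + D \<bullet> (q - xs)" using minorant r by (simp add: ereal_epigraph_def)
  then have 2: "lam * s \<le> lam * r + lam * (D \<bullet> (q - xs))"
    using lam mult_left_mono[of s "r + D \<bullet> (q - xs)" lam] by (simp add: algebra_simps)
  have "(norm (q - xs))\<^sup>2 \<le> (z - (xs - lam *\<^sub>R D)) \<bullet> (q - xs)"
    using 1 2 by (simp add: power2_norm_eq_inner algebra_simps inner_commute)
  also have "\<dots> \<le> norm (z - (xs - lam *\<^sub>R D)) * norm (q - xs)" by (rule norm_cauchy_schwarz)
  finally have "norm (q - xs) * norm (q - xs) \<le> norm (z - (xs - lam *\<^sub>R D)) * norm (q - xs)"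
    by (simp add: power2_eq_square)
  then show ?thesis
    unfolding q_def by (cases "prox lam g z = xs") auto
qed

lemma solution_affine_minorant:
  fixes g :: "'a::real_inner \<Rightarrow> ereal"
  assumes g: "closed_convex_proper g"
    and sol: "is_arg_min (\<lambda>x. g x + ereal (F x)) (\<lambda>_. True) xs"
    and D: "GDERIV F xs :> D"
  obtains s where "g xs = ereal s"
    and "\<And>x t. (x, t) \<in> ereal_epigraph g \<Longrightarrow> s \<le> t + D \<bullet> (x - xs)"
proof -
  have min: "g xs + ereal (F xs) \<le> g x + ereal (F x)" for x
    using sol by (auto simp: is_arg_min_def not_less)
  obtain x1 where "g x1 \<noteq> \<infinity>" using g by (auto simp: closed_convex_proper_def)
  then have "g xs \<noteq> \<infinity>" using min[of x1] by auto
  moreover have "g xs \<noteq> -\<infinity>" using g by (simp add: closed_convex_proper_def)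
  ultimately obtain s where s: "g xs = ereal s" by (cases "g xs") auto
  have "1 * s + F xs \<le> 1 * t + F x" if "(x, t) \<in> ereal_epigraph g" for x t
  proof -
    have "g x + ereal (F x) \<le> ereal t + ereal (F x)"
      using that by (intro add_right_mono) (auto simp: ereal_epigraph_def)
    with min[of x] have "ereal s + ereal (F xs) \<le> ereal t + ereal (F x)"
      unfolding s by (rule order_trans)
    then show ?thesis by simp
  qed
  then have "1 * s \<le> 1 * t + D \<bullet> (x - xs)" if "(x, t) \<in> ereal_epigraph g" for x t
    using g s that D by (intro first_order_optimality[where E = "ereal_epigraph g" and \<phi> = F])
      (auto simp: closed_convex_proper_def ereal_epigraph_def)
  with s that show thesis by simp
qed

section \<open>Contraction of the Lyapunov function in one step\<close>

text \<open>Over the random index, the search direction has mean \<open>\<Sum>p\<^sub>i A\<^sub>i\<close> because \<open>B\<close> enters centred.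
  Its second moment is split by \<open>\<parallel>u - v\<parallel>\<^sup>2 \<le> 2\<parallel>u\<parallel>\<^sup>2 + 2\<parallel>v\<parallel>\<^sup>2\<close>, and the variance of \<open>B\<close> is at most
  its second moment.\<close>

lemma control_variate_second_moment:
  fixes A B :: "'i \<Rightarrow> 'a::real_inner" and d :: 'a and p :: "'i \<Rightarrow> real"
  assumes p: "\<And>i. i \<in> S \<Longrightarrow> p i \<ge> 0" and sum_p: "(\<Sum>i\<in>S. p i) = 1"
  defines "m \<equiv> \<Sum>i\<in>S. p i *\<^sub>R B i"
  shows "(\<Sum>i\<in>S. p i * (norm (d - lam *\<^sub>R (A i - B i + m)))\<^sup>2)
    \<le> (norm d)\<^sup>2 - 2 * lam * (d \<bullet> (\<Sum>i\<in>S. p i *\<^sub>R A i))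
      + 2 * lam\<^sup>2 * (\<Sum>i\<in>S. p i * (norm (A i))\<^sup>2) + 2 * lam\<^sup>2 * (\<Sum>i\<in>S. p i * (norm (B i))\<^sup>2)"
proof -
  have split: "(norm (d - lam *\<^sub>R (a - b + m)))\<^sup>2
      \<le> (norm d)\<^sup>2 - 2 * lam * (d \<bullet> a) + 2 * lam * (d \<bullet> b) - 2 * lam * (d \<bullet> m)
        + 2 * lam\<^sup>2 * (norm a)\<^sup>2 + 2 * lam\<^sup>2 * ((norm b)\<^sup>2 - 2 * (b \<bullet> m) + (norm m)\<^sup>2)" for a b
  proof -
    \<comment> \<open>\<open>2\<parallel>a\<parallel>\<^sup>2 + 2\<parallel>b - m\<parallel>\<^sup>2 - \<parallel>a - (b - m)\<parallel>\<^sup>2 = \<parallel>a + (b - m)\<parallel>\<^sup>2\<close>\<close>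
    have "0 \<le> (norm (lam *\<^sub>R (a + b - m)))\<^sup>2" by simp
    then show ?thesis
      unfolding power2_norm_eq_inner by (simp add: algebra_simps inner_commute power2_eq_square)
  qed
  have pa: "(\<Sum>i\<in>S. p i * (v \<bullet> A i)) = v \<bullet> (\<Sum>i\<in>S. p i *\<^sub>R A i)" for v
    by (simp add: inner_sum_right)
  have pb: "(\<Sum>i\<in>S. p i * (v \<bullet> B i)) = v \<bullet> m" for v
    by (simp add: inner_sum_right m_def)
  have pb': "(\<Sum>i\<in>S. p i * (B i \<bullet> m)) = m \<bullet> m"
    using pb[of m] by (simp add: inner_commute)
  have const: "(\<Sum>i\<in>S. p i * c) = c" for c :: real
    using sum_p by (simp flip: sum_distrib_right)
  have "(\<Sum>i\<in>S. p i * (norm (d - lam *\<^sub>R (A i - B i + m)))\<^sup>2)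
    \<le> (\<Sum>i\<in>S. p i * ((norm d)\<^sup>2 - 2 * lam * (d \<bullet> A i) + 2 * lam * (d \<bullet> B i) - 2 * lam * (d \<bullet> m)
        + 2 * lam\<^sup>2 * (norm (A i))\<^sup>2 + 2 * lam\<^sup>2 * ((norm (B i))\<^sup>2 - 2 * (B i \<bullet> m) + (norm m)\<^sup>2)))"
    using p by (intro sum_mono mult_left_mono split) auto
  also have "\<dots> = (\<Sum>i\<in>S. p i * (norm d)\<^sup>2 - 2 * lam * (p i * (d \<bullet> A i)) + 2 * lam * (p i * (d \<bullet> B i))
        - p i * (2 * lam * (d \<bullet> m)) + 2 * lam\<^sup>2 * (p i * (norm (A i))\<^sup>2)
        + 2 * lam\<^sup>2 * (p i * (norm (B i))\<^sup>2) - 4 * lam\<^sup>2 * (p i * (B i \<bullet> m))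
        + p i * (2 * lam\<^sup>2 * (norm m)\<^sup>2))"
    by (intro sum.cong refl) (simp add: algebra_simps)
  also have "\<dots> = (norm d)\<^sup>2 - 2 * lam * (d \<bullet> (\<Sum>i\<in>S. p i *\<^sub>R A i))
      + 2 * lam\<^sup>2 * (\<Sum>i\<in>S. p i * (norm (A i))\<^sup>2) + 2 * lam\<^sup>2 * (\<Sum>i\<in>S. p i * (norm (B i))\<^sup>2)
      - 2 * lam\<^sup>2 * (norm m)\<^sup>2"
    by (simp add: sum.distrib sum_subtractf const pa pb pb' power2_norm_eq_inner
        flip: sum_distrib_left)
  also have "\<dots> \<le> (norm d)\<^sup>2 - 2 * lam * (d \<bullet> (\<Sum>i\<in>S. p i *\<^sub>R A i))
      + 2 * lam\<^sup>2 * (\<Sum>i\<in>S. p i * (norm (A i))\<^sup>2) + 2 * lam\<^sup>2 * (\<Sum>i\<in>S. p i * (norm (B i))\<^sup>2)"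
    by simp
  finally show ?thesis .
qed

definition saga_lyapunov ::
    "nat \<Rightarrow> (nat \<Rightarrow> real) \<Rightarrow> (nat \<Rightarrow> 'a::real_inner \<Rightarrow> real) \<Rightarrow> 'a \<Rightarrow> 'a \<times> (nat \<Rightarrow> 'a) \<Rightarrow> real" where
  "saga_lyapunov n c f xs s =
     (norm (fst s - xs))\<^sup>2 + (\<Sum>i = 1..n. c i * (norm (snd s i - grad (f i) xs))\<^sup>2)"

text \<open>The inner product \<open>\<langle>x - xs, \<nabla>F x - \<nabla>F xs\<rangle>\<close> occurs twice: one copy pays, by strong convexity,
  for the decrease of \<open>\<parallel>x - xs\<parallel>\<^sup>2\<close>; the other absorbs, by cocoercivity of each \<open>\<nabla>f\<^sub>i\<close>, all terms
  in \<open>\<parallel>\<nabla>f\<^sub>i x - \<nabla>f\<^sub>i xs\<parallel>\<^sup>2\<close>. The two conditions on the table weights \<open>c\<close> are the balances of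
  the coefficients of the table errors and of these gradient differences.\<close>

lemma saga_lyapunov_contraction:
  fixes f :: "nat \<Rightarrow> 'a::euclidean_space \<Rightarrow> real"
  assumes n: "n \<ge> 1" and p: "\<And>i. i \<in> {1..n} \<Longrightarrow> p i > 0" and sum_p: "(\<Sum>i = 1..n. p i) = 1"
    and lam: "lam > 0"
    and nonexp: "\<And>z. norm (prox lam g z - xs)
        \<le> norm (z - (xs - lam *\<^sub>R ((1 / real n) *\<^sub>R (\<Sum>i = 1..n. grad (f i) xs))))"
    and mono: "\<And>x. \<mu> * (norm (x - xs))\<^sup>2
        \<le> (x - xs) \<bullet> ((1 / real n) *\<^sub>R (\<Sum>i = 1..n. grad (f i) x - grad (f i) xs))"
    and coco: "\<And>i x. i \<in> {1..n} \<Longrightarrow>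
        1 / Ls i * (norm (grad (f i) x - grad (f i) xs))\<^sup>2 \<le> (grad (f i) x - grad (f i) xs) \<bullet> (x - xs)"
    and table: "\<And>i. i \<in> {1..n} \<Longrightarrow>
        2 * lam\<^sup>2 / ((real n)\<^sup>2 * p i) + (1 - p i) * c i \<le> (1 - \<mu> * lam) * c i"
    and gradients: "\<And>i. i \<in> {1..n} \<Longrightarrow>
        2 * lam\<^sup>2 / ((real n)\<^sup>2 * p i) + p i * c i \<le> lam / (real n * Ls i)"
  shows "(\<Sum>i = 1..n. p i * saga_lyapunov n c f xs (saga_step n g f p lam i s))
    \<le> (1 - \<mu> * lam) * saga_lyapunov n c f xs s"
proof -
  obtain x y where s: "s = (x, y)" by force
  define a where "a i = grad (f i) x - grad (f i) xs" for i
  define b where "b i = y i - grad (f i) xs" for i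
  define d where "d = x - xs"
  define A where "A i = (1 / (real n * p i)) *\<^sub>R a i" for i
  define B where "B i = (1 / (real n * p i)) *\<^sub>R b i" for i
  define z where "z i = x - (lam / real n) *\<^sub>R ((1 / p i) *\<^sub>R (grad (f i) x - y i) + (\<Sum>j = 1..n. y j))" for i
  have step: "saga_step n g f p lam i s = (prox lam g (z i), y(i := grad (f i) x))" for i
    by (simp add: saga_step_def s z_def Let_def)
  have pA: "(\<Sum>i = 1..n. p i *\<^sub>R A i) = (1 / real n) *\<^sub>R (\<Sum>i = 1..n. a i)"
    unfolding scaleR_right.sum using p by (intro sum.cong refl) (force simp: A_def)
  have pB: "(\<Sum>i = 1..n. p i *\<^sub>R B i) = (1 / real n) *\<^sub>R (\<Sum>i = 1..n. b i)"
    unfolding scaleR_right.sum using p by (intro sum.cong refl) (force simp: B_def)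
  have normA: "p i * (norm (A i))\<^sup>2 = (norm (a i))\<^sup>2 / ((real n)\<^sup>2 * p i)"
    and normB: "p i * (norm (B i))\<^sup>2 = (norm (b i))\<^sup>2 / ((real n)\<^sup>2 * p i)" if "i \<in> {1..n}" for i
    using p[OF that] n by (auto simp: A_def B_def power_mult_distrib power_divide power2_eq_square)
  have z: "z i - (xs - lam *\<^sub>R ((1 / real n) *\<^sub>R (\<Sum>i = 1..n. grad (f i) xs)))
      = d - lam *\<^sub>R (A i - B i + (\<Sum>i = 1..n. p i *\<^sub>R B i))" for i
  proof -
    have "A i - B i = (1 / (real n * p i)) *\<^sub>R (grad (f i) x - y i)"
      by (simp add: A_def B_def a_def b_def flip: scaleR_diff_right)
    then show ?thesis
      by (simp only: pB) (simp add: z_def d_def b_def sum_subtractf algebra_simps)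
  qed
  have prox_le: "(norm (prox lam g (z i) - xs))\<^sup>2
      \<le> (norm (d - lam *\<^sub>R (A i - B i + (\<Sum>i = 1..n. p i *\<^sub>R B i))))\<^sup>2" for i
    using nonexp[of "z i"] unfolding z by (rule power_mono) simp
  have "(\<Sum>i = 1..n. p i * (norm (prox lam g (z i) - xs))\<^sup>2)
      \<le> (\<Sum>i = 1..n. p i * (norm (d - lam *\<^sub>R (A i - B i + (\<Sum>i = 1..n. p i *\<^sub>R B i))))\<^sup>2)"
    using p prox_le by (intro sum_mono mult_left_mono) (auto intro: less_imp_le)
  also have "\<dots> \<le> (norm d)\<^sup>2 - 2 * lam * (d \<bullet> (\<Sum>i = 1..n. p i *\<^sub>R A i))
      + 2 * lam\<^sup>2 * (\<Sum>i = 1..n. p i * (norm (A i))\<^sup>2) + 2 * lam\<^sup>2 * (\<Sum>i = 1..n. p i * (norm (B i))\<^sup>2)"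
    using p sum_p by (intro control_variate_second_moment) (auto intro: less_imp_le)
  also have "\<dots> = (norm d)\<^sup>2 - 2 * lam * (d \<bullet> ((1 / real n) *\<^sub>R (\<Sum>i = 1..n. a i)))
      + (\<Sum>i = 1..n. 2 * lam\<^sup>2 / ((real n)\<^sup>2 * p i) * (norm (a i))\<^sup>2)
      + (\<Sum>i = 1..n. 2 * lam\<^sup>2 / ((real n)\<^sup>2 * p i) * (norm (b i))\<^sup>2)"
    unfolding pA by (simp add: normA normB sum_distrib_left)
  finally have dist: "(\<Sum>i = 1..n. p i * (norm (prox lam g (z i) - xs))\<^sup>2) \<le> \<dots>" .
  \<comment> \<open>entry \<open>j\<close> is refreshed to \<open>\<nabla>f\<^sub>j x\<close> with probability \<open>p\<^sub>j\<close> and kept otherwise\<close>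
  have upd: "(\<Sum>i = 1..n. p i * (\<Sum>j = 1..n. c j * (norm ((y(i := grad (f i) x)) j - grad (f j) xs))\<^sup>2))
      = (\<Sum>j = 1..n. (1 - p j) * c j * (norm (b j))\<^sup>2 + p j * c j * (norm (a j))\<^sup>2)"
  proof -
    have "(\<Sum>i = 1..n. p i * (\<Sum>j = 1..n. c j * (norm ((y(i := grad (f i) x)) j - grad (f j) xs))\<^sup>2))
      = (\<Sum>j = 1..n. \<Sum>i = 1..n. p i * (c j * (norm ((y(i := grad (f i) x)) j - grad (f j) xs))\<^sup>2))"
      unfolding sum_distrib_left by (rule sum.swap)
    also have "\<dots> = (\<Sum>j = 1..n. (1 - p j) * c j * (norm (b j))\<^sup>2 + p j * c j * (norm (a j))\<^sup>2)"
    proof (intro sum.cong refl)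
      fix j assume j: "j \<in> {1..n}"
      have "(\<Sum>i = 1..n. p i * (c j * (norm ((y(i := grad (f i) x)) j - grad (f j) xs))\<^sup>2))
        = (\<Sum>i = 1..n. p i * (c j * (norm (b j))\<^sup>2)
            + (if i = j then p j * (c j * (norm (a j))\<^sup>2) - p j * (c j * (norm (b j))\<^sup>2) else 0))"
        by (intro sum.cong refl) (auto simp: a_def b_def)
      also have "\<dots> = c j * (norm (b j))\<^sup>2 + (p j * (c j * (norm (a j))\<^sup>2) - p j * (c j * (norm (b j))\<^sup>2))"
        using j sum_p by (simp add: sum.distrib flip: sum_distrib_right)
      finally show "(\<Sum>i = 1..n. p i * (c j * (norm ((y(i := grad (f i) x)) j - grad (f j) xs))\<^sup>2))
        = (1 - p j) * c j * (norm (b j))\<^sup>2 + p j * c j * (norm (a j))\<^sup>2"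
        by (simp add: algebra_simps)
    qed
    finally show ?thesis .
  qed
  have strong: "\<mu> * (norm d)\<^sup>2 \<le> d \<bullet> ((1 / real n) *\<^sub>R (\<Sum>i = 1..n. a i))"
    using mono[of x] by (simp add: d_def a_def)
  have cocoercive: "(\<Sum>i = 1..n. lam / (real n * Ls i) * (norm (a i))\<^sup>2)
      \<le> lam * (d \<bullet> ((1 / real n) *\<^sub>R (\<Sum>i = 1..n. a i)))"
  proof -
    have "(\<Sum>i = 1..n. lam / (real n * Ls i) * (norm (a i))\<^sup>2)
        = (\<Sum>i = 1..n. (lam / real n) * (1 / Ls i * (norm (a i))\<^sup>2))" by simp
    also have "\<dots> \<le> (\<Sum>i = 1..n. (lam / real n) * (a i \<bullet> d))"
      using coco lam n unfolding a_def d_def by (intro sum_mono mult_left_mono) auto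
    also have "\<dots> = lam * (d \<bullet> ((1 / real n) *\<^sub>R (\<Sum>i = 1..n. a i)))"
      by (simp add: inner_sum_right sum_distrib_left inner_commute)
    finally show ?thesis .
  qed
  have strong': "lam * (\<mu> * (norm d)\<^sup>2) \<le> lam * (d \<bullet> ((1 / real n) *\<^sub>R (\<Sum>i = 1..n. a i)))"
    using strong lam by (intro mult_left_mono) auto
  have as: "(\<Sum>i = 1..n. 2 * lam\<^sup>2 / ((real n)\<^sup>2 * p i) * (norm (a i))\<^sup>2) + (\<Sum>i = 1..n. p i * c i * (norm (a i))\<^sup>2)
      \<le> (\<Sum>i = 1..n. lam / (real n * Ls i) * (norm (a i))\<^sup>2)"
    unfolding sum.distrib[symmetric] distrib_right[symmetric]
    by (intro sum_mono mult_right_mono gradients) auto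
  have bs: "(\<Sum>i = 1..n. 2 * lam\<^sup>2 / ((real n)\<^sup>2 * p i) * (norm (b i))\<^sup>2) + (\<Sum>i = 1..n. (1 - p i) * c i * (norm (b i))\<^sup>2)
      \<le> (1 - \<mu> * lam) * (\<Sum>i = 1..n. c i * (norm (b i))\<^sup>2)"
    unfolding sum.distrib[symmetric] distrib_right[symmetric] sum_distrib_left mult.assoc[symmetric]
    by (intro sum_mono mult_right_mono table) auto
  have "(\<Sum>i = 1..n. p i * saga_lyapunov n c f xs (saga_step n g f p lam i s))
      = (\<Sum>i = 1..n. p i * (norm (prox lam g (z i) - xs))\<^sup>2)
        + (\<Sum>i = 1..n. (1 - p i) * c i * (norm (b i))\<^sup>2) + (\<Sum>i = 1..n. p i * c i * (norm (a i))\<^sup>2)"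
    unfolding saga_lyapunov_def step fst_conv snd_conv distrib_left sum.distrib upd by simp
  also have "\<dots> \<le> (norm d)\<^sup>2 - lam * (\<mu> * (norm d)\<^sup>2) + (1 - \<mu> * lam) * (\<Sum>i = 1..n. c i * (norm (b i))\<^sup>2)"
    using dist as bs strong' cocoercive by linarith
  also have "\<dots> = (1 - \<mu> * lam) * saga_lyapunov n c f xs s"
    unfolding saga_lyapunov_def s by (simp add: d_def b_def algebra_simps)
  finally show ?thesis .
qed

section \<open>From one step to the expected error\<close>

lemma saga_cong:
  assumes "\<And>j. j < k \<Longrightarrow> i j = i' j"
  shows "saga n g f p lam x0 y0 i k = saga n g f p lam x0 y0 i' k"
  using assms by (induction k) auto

text \<open>Finitely many histories of length \<open>k\<close> exist, so any function of them is bounded and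
  measurable.\<close>

lemma integrable_of_finite_history:
  fixes h :: "(nat \<Rightarrow> nat) \<Rightarrow> real"
  assumes iid: "iid_sampling n p M I"
  shows "integrable M (\<lambda>\<omega>. h (restrict (\<lambda>j. I j \<omega>) {..<k}))"
proof -
  interpret prob_space M using iid by (simp add: iid_sampling_def)
  have I: "I j \<in> M \<rightarrow>\<^sub>M count_space {1..n}" for j
    using iid by (auto simp: iid_sampling_def indep_vars_def)
  let ?P = "PiE {..<k} (\<lambda>_. {1..n})"
  have fin: "finite ?P" by (intro finite_PiE) auto
  have H: "(\<lambda>\<omega>. restrict (\<lambda>j. I j \<omega>) {..<k}) \<in> M \<rightarrow>\<^sub>M count_space ?P"
    using measurable_restrict[of "{..<k}" I M "\<lambda>_. count_space {1..n}"] I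
    by (simp add: count_space_PiM_finite)
  have meas: "(\<lambda>\<omega>. h (restrict (\<lambda>j. I j \<omega>) {..<k})) \<in> borel_measurable M"
    using H by (rule measurable_compose) simp
  show ?thesis
  proof (rule integrable_const_bound[OF _ meas])
    show "AE \<omega> in M. norm (h (restrict (\<lambda>j. I j \<omega>) {..<k})) \<le> Max ((\<lambda>v. norm (h v)) ` ?P)"
      using measurable_space[OF H] fin by (intro AE_I2 Max_ge) auto
  qed
qed

text \<open>Conditioning on the first \<open>k\<close> indices: the index drawn at time \<open>k\<close> is independent of them.\<close>

lemma expectation_condition_on_history:
  fixes h :: "(nat \<Rightarrow> nat) \<Rightarrow> nat \<Rightarrow> real"
  assumes iid: "iid_sampling n p M I"
  shows "(LINT \<omega>|M. h (restrict (\<lambda>j. I j \<omega>) {..<k}) (I k \<omega>))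
    = (\<Sum>i = 1..n. p i * (LINT \<omega>|M. h (restrict (\<lambda>j. I j \<omega>) {..<k}) i))"
proof -
  interpret prob_space M using iid by (simp add: iid_sampling_def)
  let ?H = "\<lambda>\<omega>. restrict (\<lambda>j. I j \<omega>) {..<k}"
  let ?N = "\<lambda>_::nat. count_space {1..n}"
  have ind: "indep_vars ?N I UNIV" using iid by (simp add: iid_sampling_def)
  have I: "I j \<in> M \<rightarrow>\<^sub>M count_space {1..n}" for j
    using ind by (auto simp: indep_vars_def)
  note int = integrable_of_finite_history[OF iid]
  have factor: "(LINT \<omega>|M. indicator {i} (I k \<omega>) * h (?H \<omega>) i) = p i * (LINT \<omega>|M. h (?H \<omega>) i)"
    and factor_int: "integrable M (\<lambda>\<omega>. indicator {i} (I k \<omega>) * h (?H \<omega>) i)"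
    if i: "i \<in> {1..n}" for i
  proof -
    have "indep_var (PiM {k} ?N) (\<lambda>\<omega>. restrict (\<lambda>j. I j \<omega>) {k}) (PiM {..<k} ?N) ?H"
      by (rule indep_var_restrict[OF ind]) auto
    then have iv: "indep_var borel ((\<lambda>v. indicator {i} (v k) :: real) \<circ> (\<lambda>\<omega>. restrict (\<lambda>j. I j \<omega>) {k}))
        borel ((\<lambda>v. h v i) \<circ> ?H)"
      by (rule indep_var_compose) (simp_all add: count_space_PiM_finite)
    have ind_int: "integrable M (\<lambda>\<omega>. indicator {i} (I k \<omega>) :: real)"
      using int[where h = "\<lambda>v. indicator {i} (v k)" and k = "Suc k"] by simp
    have "{\<omega> \<in> space M. I k \<omega> = i} = I k -` {i} \<inter> space M" by auto
    then have "(LINT \<omega>|M. indicator {i} (I k \<omega>)) = measure M {\<omega> \<in> space M. I k \<omega> = i}"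
      using i I[of k]
      by (subst Bochner_Integration.integral_cong[where g = "indicator {\<omega> \<in> space M. I k \<omega> = i}" and N = M])
        (auto simp: indicator_def Int_absorb2)
    then have E: "(LINT \<omega>|M. indicator {i} (I k \<omega>)) = p i"
      using iid i by (simp add: iid_sampling_def)
    show "(LINT \<omega>|M. indicator {i} (I k \<omega>) * h (?H \<omega>) i) = p i * (LINT \<omega>|M. h (?H \<omega>) i)"
      using indep_var_lebesgue_integral[OF iv] ind_int int[where h = "\<lambda>v. h v i" and k = k]
      by (simp add: o_def E)
    show "integrable M (\<lambda>\<omega>. indicator {i} (I k \<omega>) * h (?H \<omega>) i)"
      using indep_var_integrable[OF iv] ind_int int[where h = "\<lambda>v. h v i" and k = k]
      by (simp add: o_def)
  qed
  have "(LINT \<omega>|M. h (?H \<omega>) (I k \<omega>)) = (LINT \<omega>|M. (\<Sum>i = 1..n. indicator {i} (I k \<omega>) * h (?H \<omega>) i))"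
  proof (rule Bochner_Integration.integral_cong[OF refl])
    fix \<omega> assume "\<omega> \<in> space M"
    then have "I k \<omega> \<in> {1..n}" using measurable_space[OF I[of k]] by simp
    then show "h (?H \<omega>) (I k \<omega>) = (\<Sum>i = 1..n. indicator {i} (I k \<omega>) * h (?H \<omega>) i)"
      by (simp add: indicator_def if_distrib[of "\<lambda>c. c * _"] sum.delta cong: if_cong)
  qed
  also have "\<dots> = (\<Sum>i = 1..n. p i * (LINT \<omega>|M. h (?H \<omega>) i))"
    by (subst Bochner_Integration.integral_sum[OF factor_int]) (auto intro!: sum.cong factor)
  finally show ?thesis .
qed

text \<open>The state before a step is determined by the history, so the expectation after the step is the
  expectation of the average over the next index.\<close>

lemma saga_expectation_geometric:
  assumes iid: "iid_sampling n p M I" and \<rho>: "\<rho> \<ge> 0"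
    and step: "\<And>s. (\<Sum>i = 1..n. p i * V (saga_step n g f p lam i s)) \<le> \<rho> * V s"
  shows "(LINT \<omega>|M. V (saga n g f p lam x0 y0 (\<lambda>j. I j \<omega>) k)) \<le> \<rho> ^ k * V (x0, y0)"
proof (induction k)
  case 0
  interpret prob_space M using iid by (simp add: iid_sampling_def)
  show ?case by (simp add: prob_space)
next
  case (Suc k)
  let ?H = "\<lambda>\<omega>. restrict (\<lambda>j. I j \<omega>) {..<k}"
  let ?s = "\<lambda>v. saga n g f p lam x0 y0 v k"
  note int = integrable_of_finite_history[OF iid]
  have s: "?s (\<lambda>j. I j \<omega>) = ?s (?H \<omega>)" for \<omega>
    by (rule saga_cong) simp
  have "(LINT \<omega>|M. V (saga n g f p lam x0 y0 (\<lambda>j. I j \<omega>) (Suc k)))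
      = (\<Sum>i = 1..n. p i * (LINT \<omega>|M. V (saga_step n g f p lam i (?s (?H \<omega>)))))"
    using expectation_condition_on_history[OF iid, of "\<lambda>v i. V (saga_step n g f p lam i (?s v))" k]
    by (simp add: s)
  also have "\<dots> = (LINT \<omega>|M. (\<Sum>i = 1..n. p i * V (saga_step n g f p lam i (?s (?H \<omega>)))))"
    by (subst Bochner_Integration.integral_sum)
      (auto intro!: integrable_mult_right int[where h = "\<lambda>v. V (saga_step n g f p lam _ (?s v))"])
  also have "\<dots> \<le> (LINT \<omega>|M. \<rho> * V (?s (?H \<omega>)))"
    by (intro integral_mono step integrable_mult_right int[where h = "\<lambda>v. V (?s v)"]
        int[where h = "\<lambda>v. \<Sum>i = 1..n. p i * V (saga_step n g f p lam i (?s v))"])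
  also have "\<dots> = \<rho> * (LINT \<omega>|M. V (?s (\<lambda>j. I j \<omega>)))" by (simp add: s)
  also have "\<dots> \<le> \<rho> * (\<rho> ^ k * V (x0, y0))" using Suc \<rho> by (rule mult_left_mono)
  finally show ?case by (simp add: mult.assoc)
qed

section \<open>The sampling distribution and the iteration count\<close>

text \<open>With \<open>m = n\<mu>\<close> and \<open>r\<close> the square root, \<open>w(w - 2m) = (4l + r)\<^sup>2 - m\<^sup>2 = 8l(4l + r)\<close> and
  \<open>w + (w - 2m) = 2(4l + r)\<close>. The sampling weight is the larger root of the quadratic equation
  which says that the gradient terms of the Lyapunov drift cancel exactly.\<close>

lemma saga_weight_balance:
  fixes l m :: real
  assumes l: "l > 0" and m: "m \<ge> 0"
  defines "w \<equiv> 4 * l + m + sqrt ((4 * l)\<^sup>2 + m\<^sup>2)"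
  shows "w - 2 * m > 0" and "w > 0" and "1 / w + 1 / (w - 2 * m) = 1 / (4 * l)"
proof -
  define r where "r = sqrt ((4 * l)\<^sup>2 + m\<^sup>2)"
  have r2: "r * r = 16 * l * l + m * m" unfolding r_def by (simp add: power2_eq_square)
  have "r \<ge> m" unfolding r_def by (rule real_le_rsqrt) simp
  then show 1: "w - 2 * m > 0" and 2: "w > 0" using l m by (auto simp: w_def r_def)
  have w: "w = 4 * l + m + r" by (simp add: w_def r_def)
  have "(w + (w - 2 * m)) * (4 * l) = w * (w - 2 * m)"
    using r2 by (simp add: w algebra_simps)
  then show "1 / w + 1 / (w - 2 * m) = 1 / (4 * l)"
    using 1 2 l by (simp add: field_simps)
qed

text \<open>\<open>(1 - \<theta>)\<^sup>k \<le> exp (-\<theta>k)\<close>, and \<open>k \<ge> 2 / \<theta> \<sqdot> ln (1/\<epsilon>) - 1\<close> from \<open>k = \<lfloor>2 / \<theta> \<sqdot> ln (1/\<epsilon>)\<rfloor>\<close> on.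
  One of the two copies of \<open>ln (1/\<epsilon>)\<close> produces \<open>\<epsilon>\<close>; the other pays for \<open>C\<close> and the rounding.\<close>

lemma geometric_accurate_within:
  assumes e: "\<And>k. e k \<le> C * (1 - \<theta>) ^ k" and C: "C \<ge> 1" and \<theta>: "0 < \<theta>" "\<theta> < 1"
    and \<epsilon>: "0 < \<epsilon>" "\<epsilon> < exp (- 1) / C"
  shows "accurate_within e \<epsilon> (2 * (1 / \<theta> * ln (1 / \<epsilon>)))"
proof -
  have "C * exp 1 * \<epsilon> < 1" using \<epsilon> C by (simp add: exp_minus field_simps)
  then have "ln (C * exp 1 * \<epsilon>) < 0" using C \<epsilon> by (subst ln_less_zero_iff) auto
  then have lnC: "ln C + 1 < ln (1 / \<epsilon>)" using C \<epsilon> by (simp add: ln_mult ln_div)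
  define B where "B = 2 * (1 / \<theta> * ln (1 / \<epsilon>))"
  define K where "K = nat \<lfloor>B\<rfloor>"
  have "ln C \<ge> 0" using C by simp
  then have "B \<ge> 0" unfolding B_def using lnC \<theta> by (intro mult_nonneg_nonneg) auto
  then have K: "real K \<le> B" "B - 1 \<le> real K" unfolding K_def by linarith+
  have "e k \<le> \<epsilon>" if k: "k \<ge> K" for k
  proof -
    have "B - 1 \<le> real k" using K(2) k by simp
    then have "\<theta> * (B - 1) \<le> \<theta> * real k" using \<theta> by simp
    moreover have "\<theta> * B = 2 * ln (1 / \<epsilon>)" using \<theta> by (simp add: B_def)
    ultimately have "ln C - \<theta> * real k \<le> ln \<epsilon>"
      using lnC \<theta> \<epsilon> by (simp add: algebra_simps ln_div)
    then have "exp (ln C - \<theta> * real k) \<le> \<epsilon>"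
      using \<epsilon> by (metis exp_le_cancel_iff exp_ln)
    moreover have "(1 - \<theta>) ^ k \<le> exp (- \<theta>) ^ k"
      using exp_ge_add_one_self[of "- \<theta>"] \<theta> by (intro power_mono) auto
    then have "C * (1 - \<theta>) ^ k \<le> C * exp (- \<theta>) ^ k" using C by simp
    moreover have "C * exp (- \<theta>) ^ k = exp (ln C - \<theta> * real k)"
      using C by (simp add: exp_diff exp_minus field_simps flip: exp_of_nat_mult)
    ultimately show ?thesis using e[of k] by linarith
  qed
  with K(1) show ?thesis unfolding accurate_within_def B_def by blast
qed

theorem corollary6p1:
  fixes g :: "real ^ 'N \<Rightarrow> ereal"
    and f :: "nat \<Rightarrow> real ^ 'N \<Rightarrow> real"
    and Ls :: "nat \<Rightarrow> real" and L \<mu> lam :: real and p :: "nat \<Rightarrow> real"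
    and n :: nat
    and x0 xs :: "real ^ 'N" and y0 :: "nat \<Rightarrow> real ^ 'N"
  assumes problem: "problem_properties n g f Ls L \<mu>"
    and solution: "solutions n g f = {xs}"
    and p: "p = saga_prob n Ls \<mu>"
    and step: "lam = saga_stepsize n Ls \<mu>"
  shows
    "(\<forall>(M :: 'w measure) I. iid_sampling n p M I \<longrightarrow>
        (\<lambda>k. saga_mse M I n g f p lam x0 y0 xs k) \<in> O(\<lambda>k. (1 - \<mu> * lam) ^ k)) \<and>
     (\<exists>\<epsilon>0>0. \<forall>(M :: 'w measure) I. iid_sampling n p M I \<longrightarrow>
        (\<forall>\<epsilon>. 0 < \<epsilon> \<and> \<epsilon> < \<epsilon>0 \<longrightarrow>
          accurate_within (saga_mse M I n g f p lam x0 y0 xs) \<epsilon>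
            (complexity_const *
              (1 / 2 * (1 / real n * (\<Sum>i = 1..n. 4 * Ls i / \<mu> + real n
                  + sqrt ((4 * Ls i / \<mu>)\<^sup>2 + (real n)\<^sup>2)))
               * ln (1 / \<epsilon>)))))"
proof -
  define \<theta> where "\<theta> = \<mu> * lam"
  define m where "m = real n * \<mu>"
  define S where "S = saga_S n Ls \<mu>"
  define w where "w = saga_weight n Ls \<mu>"
  have n: "n \<ge> 1" and g: "closed_convex_proper g" and strong: "strongly_convex \<mu> (avg n f)"
    and smooth: "\<And>i. i \<in> {1..n} \<Longrightarrow> smooth (Ls i) (f i)"
    using problem by (auto simp: problem_properties_def)
  have \<mu>: "\<mu> > 0" using strong by (simp add: strongly_convex_def)
  have m: "m \<ge> 0" using \<mu> by (simp add: m_def)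
  have Ls: "Ls i > 0" if "i \<in> {1..n}" for i using smooth[OF that] by (simp add: smooth_def)
  have w_def': "w i = 4 * Ls i + m + sqrt ((4 * Ls i)\<^sup>2 + m\<^sup>2)" for i
    by (simp add: w_def saga_weight_def m_def)
  note balance = saga_weight_balance[OF Ls m, folded w_def']
  have sumw: "(\<Sum>i = 1..n. w i) = real n * S" using n by (simp add: S_def saga_S_def w_def)
  have "(\<Sum>i = 1..n. w i) > 0" using n balance(2) by (intro sum_pos) auto
  then have S: "S > 0" unfolding sumw using n by (simp add: zero_less_mult_iff)
  have lam: "lam = 2 / S" by (simp add: step saga_stepsize_def S_def)
  have lam0: "lam > 0" using S by (simp add: lam)
  have p_w: "p i = w i / (real n * S)" for i
    using sumw by (simp add: p saga_prob_def w_def)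
  have p0: "p i > 0" if "i \<in> {1..n}" for i
    using balance(2)[OF that] n S by (simp add: p_w)
  have sum_p: "(\<Sum>i = 1..n. p i) = 1"
    unfolding p_w sum_divide_distrib[symmetric] sumw using n S by simp
  have gap: "p i - \<theta> = (w i - 2 * m) / (real n * S)" for i
    using n S by (simp add: p_w \<theta>_def lam m_def field_simps)
  have gap0: "p i - \<theta> > 0" if "i \<in> {1..n}" for i
    using balance(1)[OF that] n S by (simp add: gap)
  have \<theta>0: "\<theta> > 0" using \<mu> lam0 by (simp add: \<theta>_def)
  have "p 1 \<le> (\<Sum>i = 1..n. p i)"
    using p0 n by (intro member_le_sum) (auto intro: less_imp_le)
  then have \<theta>1: "\<theta> < 1" using gap0[of 1] n sum_p by simp

  \<comment> \<open>the table weights for which the coefficients of the table errors contract by exactly \<open>1 - \<theta>\<close>\<close>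
  define c where "c i = 2 * lam\<^sup>2 / ((real n)\<^sup>2 * p i) / (p i - \<theta>)" for i
  have c0: "c i \<ge> 0" if "i \<in> {1..n}" for i
    using p0[OF that] gap0[OF that] by (simp add: c_def)
  have table: "2 * lam\<^sup>2 / ((real n)\<^sup>2 * p i) + (1 - p i) * c i \<le> (1 - \<mu> * lam) * c i"
    if i: "i \<in> {1..n}" for i
  proof -
    have "2 * lam\<^sup>2 / ((real n)\<^sup>2 * p i) = c i * (p i - \<theta>)" using gap0[OF i] by (simp add: c_def)
    then show ?thesis by (simp add: \<theta>_def algebra_simps)
  qed
  have gradients: "2 * lam\<^sup>2 / ((real n)\<^sup>2 * p i) + p i * c i \<le> lam / (real n * Ls i)"
    if i: "i \<in> {1..n}" for i
  proof -
    have "2 * lam\<^sup>2 / ((real n)\<^sup>2 * p i) + p i * c i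
        = 2 * lam\<^sup>2 / (real n)\<^sup>2 * (1 / p i + 1 / (p i - \<theta>))"
      using p0[OF i] by (simp add: c_def distrib_left)
    also have "1 / p i + 1 / (p i - \<theta>) = real n * S * (1 / w i + 1 / (w i - 2 * m))"
      by (simp add: gap) (simp add: p_w distrib_left)
    also have "\<dots> = real n * S / (4 * Ls i)" by (simp add: balance(3)[OF i])
    also have "2 * lam\<^sup>2 / (real n)\<^sup>2 * (real n * S / (4 * Ls i)) = lam / (real n * Ls i)"
      using n S Ls[OF i] by (simp add: lam field_simps power2_eq_square)
    finally show ?thesis by simp
  qed

  have diff: "f i differentiable (at x)" if "i \<in> {1..n}" for i x
    using smooth[OF that] by (simp add: smooth_def)
  have grad_avg: "GDERIV (avg n f) x :> (1 / real n) *\<^sub>R (\<Sum>i = 1..n. grad (f i) x)" for x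
    using diff by (rule GDERIV_avg)
  have "xs \<in> solutions n g f" using solution by simp
  then have "is_arg_min (\<lambda>x. g x + ereal (avg n f x)) (\<lambda>_. True) xs" by (simp add: solutions_def)
  from solution_affine_minorant[OF g this grad_avg] obtain s where
    s: "g xs = ereal s" "\<And>x t. (x, t) \<in> ereal_epigraph g \<Longrightarrow>
      s \<le> t + ((1 / real n) *\<^sub>R (\<Sum>i = 1..n. grad (f i) xs)) \<bullet> (x - xs)" by blast
  note nonexp = prox_nonexpansive_at_solution[OF g lam0 s]
  have mono: "\<mu> * (norm (x - xs))\<^sup>2
      \<le> (x - xs) \<bullet> ((1 / real n) *\<^sub>R (\<Sum>i = 1..n. grad (f i) x - grad (f i) xs))" for x
    using strongly_convex_gradient_monotone[OF strong grad_avg grad_avg, of x xs]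
    by (simp only: sum_subtractf scaleR_diff_right)
  have coco: "1 / Ls i * (norm (grad (f i) x - grad (f i) xs))\<^sup>2
      \<le> (grad (f i) x - grad (f i) xs) \<bullet> (x - xs)" if "i \<in> {1..n}" for i x
    using smooth[OF that] by (simp add: smooth_def)

  define V where "V = saga_lyapunov n c f xs"
  have V: "(norm (fst s - xs))\<^sup>2 \<le> V s" for s
    using c0 unfolding V_def saga_lyapunov_def by (auto intro!: sum_nonneg)
  have contraction: "(\<Sum>i = 1..n. p i * V (saga_step n g f p lam i s)) \<le> (1 - \<theta>) * V s" for s
    unfolding V_def \<theta>_def
    by (rule saga_lyapunov_contraction[OF n p0 sum_p lam0 nonexp mono coco table gradients])
  define C where "C = max 1 (V (x0, y0))"
  have rate: "saga_mse M I n g f p lam x0 y0 xs k \<le> C * (1 - \<theta>) ^ k"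
    if iid: "iid_sampling n p M I" for M :: "'w measure" and I k
  proof -
    let ?s = "\<lambda>v. saga n g f p lam x0 y0 v k"
    have int: "integrable M (\<lambda>\<omega>. h (?s (\<lambda>j. I j \<omega>)))" for h :: "_ \<Rightarrow> real"
    proof -
      have "?s (\<lambda>j. I j \<omega>) = ?s (restrict (\<lambda>j. I j \<omega>) {..<k})" for \<omega> by (rule saga_cong) simp
      then show ?thesis
        using integrable_of_finite_history[OF iid, where h = "\<lambda>v. h (?s v)" and k = k]
        by simp
    qed
    have "saga_mse M I n g f p lam x0 y0 xs k \<le> (LINT \<omega>|M. V (?s (\<lambda>j. I j \<omega>)))"
      unfolding saga_mse_def
      by (intro integral_mono V int[of V] int[of "\<lambda>s. (norm (fst s - xs))\<^sup>2"])
    also have "\<dots> \<le> (1 - \<theta>) ^ k * V (x0, y0)"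
      using iid \<theta>1 contraction by (intro saga_expectation_geometric) auto
    also have "\<dots> \<le> (1 - \<theta>) ^ k * C" using \<theta>1 by (intro mult_left_mono) (auto simp: C_def)
    finally show ?thesis by (simp add: mult.commute)
  qed
  have bound: "1 / 2 * (1 / real n * (\<Sum>i = 1..n. 4 * Ls i / \<mu> + real n
      + sqrt ((4 * Ls i / \<mu>)\<^sup>2 + (real n)\<^sup>2))) = 1 / \<theta>"
  proof -
    have "4 * Ls i / \<mu> + real n + sqrt ((4 * Ls i / \<mu>)\<^sup>2 + (real n)\<^sup>2) = w i / \<mu>" for i
    proof -
      have "(4 * Ls i / \<mu>)\<^sup>2 + (real n)\<^sup>2 = ((4 * Ls i)\<^sup>2 + m\<^sup>2) / \<mu>\<^sup>2"
        using \<mu> by (simp add: m_def field_simps)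
      then have "sqrt ((4 * Ls i / \<mu>)\<^sup>2 + (real n)\<^sup>2) = sqrt ((4 * Ls i)\<^sup>2 + m\<^sup>2) / \<mu>"
        using \<mu> by (simp add: real_sqrt_divide)
      then show ?thesis using \<mu> by (simp add: w_def' m_def add_divide_distrib)
    qed
    then show ?thesis
      using n S by (simp only: sumw flip: sum_divide_distrib) (simp add: \<theta>_def lam)
  qed
  show ?thesis
  proof (intro conjI allI impI)
    fix M :: "'w measure" and I assume iid: "iid_sampling n p M I"
    have "norm (saga_mse M I n g f p lam x0 y0 xs k) \<le> C * norm ((1 - \<mu> * lam) ^ k)" for k
    proof -
      have "saga_mse M I n g f p lam x0 y0 xs k \<ge> 0" unfolding saga_mse_def by simp
      then show ?thesis using rate[OF iid, of k] \<theta>1 by (simp add: \<theta>_def)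
    qed
    then show "(\<lambda>k. saga_mse M I n g f p lam x0 y0 xs k) \<in> O(\<lambda>k. (1 - \<mu> * lam) ^ k)"
      by (intro bigoI[where c = C] always_eventually) auto
  next
    have C: "C \<ge> 1" by (simp add: C_def)
    show "\<exists>\<epsilon>0>0. \<forall>(M :: 'w measure) I. iid_sampling n p M I \<longrightarrow>
        (\<forall>\<epsilon>. 0 < \<epsilon> \<and> \<epsilon> < \<epsilon>0 \<longrightarrow>
          accurate_within (saga_mse M I n g f p lam x0 y0 xs) \<epsilon>
            (complexity_const *
              (1 / 2 * (1 / real n * (\<Sum>i = 1..n. 4 * Ls i / \<mu> + real n
                  + sqrt ((4 * Ls i / \<mu>)\<^sup>2 + (real n)\<^sup>2)))
               * ln (1 / \<epsilon>))))"
      unfolding bound complexity_const_def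
      using C geometric_accurate_within[OF rate C \<theta>0 \<theta>1]
      by (intro exI[of _ "exp (- 1) / C"] conjI allI impI) (blast | simp)+
  qed
qed

end
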